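(* There exist constants $0<c_1<c_2$ such that for all integers $d\ge 2$, \[ \frac{1}{2}+\frac{c_1}{\sqrt{d}}\le \gamma_{2,d}\le \frac{1}{2}+\frac{c_2}{\sqrt{d}}. \]
   Context: For integers $k\ge 2$ and $n\ge 1$ let $[k]=\{1,\dots,k\}$. A subsequence of a string is obtained by deleting zero or more of its characters. For strings $X^1,\dots,X^d$, $\mathrm{LCS}(X^1,\dots,X^d)$ denotes the length of a longest string that is a subsequence of every $X^i$. The generalized Chvátal–Sankoff constant is \[ \gamma_{k,d}=\lim_{n\to\infty}\frac{\mathbb{E}[\mathrm{LCS}(X^1,\dots,X^d)]}{n}, \] where $X^1,\dots,X^d$ are independent uniformly random strings in $[k]^n$ (this limit exists). *)

theory Defs
  imports "HOL-Probability.Probability" "HOL-Library.Sublist"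
begin

definition strings :: "nat \<Rightarrow> nat \<Rightarrow> nat list set" where
  "strings k n = {w. set w \<subseteq> {1..k} \<and> length w = n}"

text \<open>\<open>subseq\<close> is the library's order of not necessarily contiguous subsequences. The set
  under \<open>Max\<close> contains \<open>0\<close> and is finite as soon as \<open>I\<close> is nonempty.\<close>

definition LCS :: "'i set \<Rightarrow> ('i \<Rightarrow> 'a list) \<Rightarrow> nat" where
  "LCS I X = Max {length w | w. \<forall>i\<in>I. subseq w (X i)}"

text \<open>The \<open>d\<close>-fold product of the uniform distribution on strings. The argument \<open>[]\<close> is only
  the dummy value that \<open>Pi_pmf\<close> assigns to indices outside \<open>{1..d}\<close>.\<close>

definition random_strings :: "nat \<Rightarrow> nat \<Rightarrow> nat \<Rightarrow> (nat \<Rightarrow> nat list) pmf" where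
  "random_strings k d n = Pi_pmf {1..d} [] (\<lambda>_. pmf_of_set (strings k n))"

definition expected_LCS :: "nat \<Rightarrow> nat \<Rightarrow> nat \<Rightarrow> real" where
  "expected_LCS k d n =
     measure_pmf.expectation (random_strings k d n) (\<lambda>X. real (LCS {1..d} X))"

definition chvatal_sankoff :: "nat \<Rightarrow> nat \<Rightarrow> real" where
  "chvatal_sankoff k d = lim (\<lambda>n. expected_LCS k d n / real n)"

lemma finite_strings: "finite (strings k n)"
  unfolding strings_def by (rule finite_lists_length_eq) simp

lemma strings_nonempty:
  assumes "k \<ge> 1"
  shows "strings k n \<noteq> {}"
proof -
  have "replicate n 1 \<in> strings k n"
    using assms by (auto simp: strings_def)
  then show ?thesis by blast
qed

lemma finite_common_subseq_lengths:
  assumes "I \<noteq> {}"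
  shows "finite {length w | w. \<forall>i\<in>I. subseq w (X i)}"
proof -
  obtain i where "i \<in> I" using assms by blast
  then have "{length w | w. \<forall>i\<in>I. subseq w (X i)} \<subseteq> {..length (X i)}"
    by (auto dest: list_emb_length)
  then show ?thesis by (rule finite_subset) simp
qed

end

theory Submission
  imports Defs
begin

text \<open>The mean LCS length is superadditive in \<open>n\<close>, so by Fekete's lemma the limit exists.

  Upper bound: a fixed word of length \<open>l\<close> is a subsequence of a uniformly random word of length
  \<open>n\<close> with probability \<open>P(Bin(n, 1/2) \<ge> l)\<close>. For \<open>l = (1/2 + s) n\<close> this is exponentially small
  at rate of order \<open>s\<^sup>2\<close>, so a union bound over the \<open>2^l\<close> words shows that no such word is common
  to all \<open>d\<close> strings as soon as \<open>s\<^sup>2 d\<close> exceeds a constant.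

  Lower bound: build a common subsequence greedily, always appending the letter that is at the front
  of a majority of the strings. A string whose front letter agrees loses one letter, any other string
  loses three on average. A front letter agrees with the majority with probability \<open>1/2 + q/2\<close>,
  where \<open>q\<close> is the central binomial probability for \<open>d - 1\<close> coins, of order \<open>1 / sqrt d\<close>. So
  each string loses \<open>2 - q\<close> letters per round on average, and by a Chernoff bound the greedy strategy
  completes about \<open>n / (2 - q)\<close> rounds.\<close>

subsection \<open>Longest common subsequences\<close>

lemma LCS_witness:
  assumes "I \<noteq> {}"
  obtains w where "\<forall>i\<in>I. subseq w (X i)" "length w = LCS I X"
proof -
  have "LCS I X \<in> {length w | w. \<forall>i\<in>I. subseq w (X i)}"
    unfolding LCS_def
    by (rule Max_in[OF finite_common_subseq_lengths[OF assms]]) (auto intro!: exI[of _ "[]"])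
  then show thesis using that by auto
qed

lemma length_le_LCS:
  assumes "I \<noteq> {}" "\<And>i. i \<in> I \<Longrightarrow> subseq w (X i)"
  shows "length w \<le> LCS I X"
  unfolding LCS_def
  by (rule Max_ge[OF finite_common_subseq_lengths[OF assms(1)]]) (use assms(2) in blast)

lemma LCS_cong: "(\<And>i. i \<in> I \<Longrightarrow> X i = Y i) \<Longrightarrow> LCS I X = LCS I Y"
  by (simp add: LCS_def)

lemma LCS_le_length:
  assumes "i \<in> I"
  shows "LCS I X \<le> length (X i)"
proof -
  have "I \<noteq> {}" using assms by blast
  then obtain w where w: "\<forall>i\<in>I. subseq w (X i)" "length w = LCS I X"
    by (rule LCS_witness)
  then have "subseq w (X i)" using assms by blast
  then show ?thesis using list_emb_length w(2) by fastforce
qed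

lemma LCS_mono:
  assumes "I \<noteq> {}" "\<And>i. i \<in> I \<Longrightarrow> subseq (X i) (Y i)"
  shows "LCS I X \<le> LCS I Y"
proof -
  obtain w where w: "\<forall>i\<in>I. subseq w (X i)" "length w = LCS I X"
    by (rule LCS_witness[OF assms(1)])
  have "subseq w (Y i)" if "i \<in> I" for i
    using w(1) assms(2) that subseq_order.trans by blast
  then show ?thesis using length_le_LCS[OF assms(1)] w(2) by metis
qed

lemma LCS_append:
  assumes "I \<noteq> {}"
  shows "LCS I X + LCS I Y \<le> LCS I (\<lambda>i. X i @ Y i)"
proof -
  obtain u where u: "\<forall>i\<in>I. subseq u (X i)" "length u = LCS I X"
    by (rule LCS_witness[OF assms])
  obtain w where w: "\<forall>i\<in>I. subseq w (Y i)" "length w = LCS I Y"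
    by (rule LCS_witness[OF assms])
  have "length (u @ w) \<le> LCS I (\<lambda>i. X i @ Y i)"
    using u w by (intro length_le_LCS[OF assms]) (auto intro: list_emb_append_mono)
  with u w show ?thesis by simp
qed

lemma LCS_Cons:
  assumes "I \<noteq> {}"
  shows "Suc (LCS I X) \<le> LCS I (\<lambda>i. a # X i)"
proof -
  obtain u where u: "\<forall>i\<in>I. subseq u (X i)" "length u = LCS I X"
    by (rule LCS_witness[OF assms])
  have "length (a # u) \<le> LCS I (\<lambda>i. a # X i)"
    using u by (intro length_le_LCS[OF assms]) auto
  with u show ?thesis by simp
qed

section \<open>Expectations under finitely supported and product distributions\<close>

lemma expectation_bind_finite:
  fixes h :: "'b \<Rightarrow> real"
  assumes "finite (set_pmf p)" "\<And>x. x \<in> set_pmf p \<Longrightarrow> finite (set_pmf (f x))"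
  shows "measure_pmf.expectation (p \<bind> f) h =
    measure_pmf.expectation p (\<lambda>x. measure_pmf.expectation (f x) h)"
  using assms
  by (subst pmf_expectation_bind[of "set_pmf p"])
     (auto simp: integral_measure_pmf_real[of "set_pmf p"] mult.commute)

lemma expectation_mono_finite:
  fixes f g :: "'a \<Rightarrow> real"
  assumes "finite (set_pmf p)" "\<And>x. x \<in> set_pmf p \<Longrightarrow> f x \<le> g x"
  shows "measure_pmf.expectation p f \<le> measure_pmf.expectation p g"
  using assms by (intro integral_mono_AE integrable_measure_pmf_finite) (auto simp: AE_measure_pmf_iff)

lemma finite_set_Pi_pmf:
  assumes "finite I" "\<And>i. i \<in> I \<Longrightarrow> finite (set_pmf (p i))"
  shows "finite (set_pmf (Pi_pmf I dflt p))"
  using assms by (simp add: set_Pi_pmf finite_PiE_dflt)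

lemma in_set_Pi_pmfD:
  "finite I \<Longrightarrow> f \<in> set_pmf (Pi_pmf I dflt p) \<Longrightarrow> i \<in> I \<Longrightarrow> f i \<in> set_pmf (p i)"
  by (auto simp: set_Pi_pmf PiE_dflt_def)

text \<open>The map varies with the index because each string is extended or shortened in its own
  way. As \<open>f i dflt\<close> may differ from \<open>dflt'\<close>, the value outside
  \<open>I\<close> is reset explicitly.\<close>

lemma Pi_pmf_map_dependent:
  assumes "finite I"
  shows "Pi_pmf I dflt' (\<lambda>i. map_pmf (f i) (p i)) =
    map_pmf (\<lambda>h i. if i \<in> I then f i (h i) else dflt') (Pi_pmf I dflt p)"
  unfolding map_pmf_def using assms
  by (subst Pi_pmf_bind[where d' = dflt]) auto

lemma expectation_Pi_component:
  fixes g :: "'b \<Rightarrow> real"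
  assumes "finite I" "i \<in> I"
  shows "measure_pmf.expectation (Pi_pmf I dflt p) (\<lambda>f. g (f i)) = measure_pmf.expectation (p i) g"
proof -
  have "measure_pmf.expectation (Pi_pmf I dflt p) (\<lambda>f. g (f i)) =
    measure_pmf.expectation (map_pmf (\<lambda>f. f i) (Pi_pmf I dflt p)) g" by simp
  also have "map_pmf (\<lambda>f. f i) (Pi_pmf I dflt p) = p i"
    using assms by (simp add: Pi_pmf_component)
  finally show ?thesis .
qed

subsection \<open>Random binary words\<close>

definition coin :: "bool pmf" where
  "coin = bernoulli_pmf (1/2)"

definition letter :: "bool \<Rightarrow> nat" where
  "letter b = (if b then 1 else 2)"

definition rword :: "nat \<Rightarrow> nat list pmf" where
  "rword n = pmf_of_set (strings 2 n)"

lemma set_pmf_rword: "set_pmf (rword n) = strings 2 n"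
  by (simp add: rword_def set_pmf_of_set finite_strings strings_nonempty)

lemma finite_rword [simp]: "finite (set_pmf (rword n))"
  by (simp add: set_pmf_rword finite_strings)

lemma length_rword: "w \<in> set_pmf (rword n) \<Longrightarrow> length w = n"
  by (simp add: set_pmf_rword strings_def)

lemma expectation_coin: "measure_pmf.expectation coin f = (f True + f False) / (2::real)"
  by (simp add: coin_def integral_bernoulli_pmf)

lemma finite_coin [simp]: "finite (set_pmf (p :: bool pmf))"
  by (rule finite_subset[OF subset_UNIV]) simp

lemma rword_0: "rword 0 = return_pmf []"
proof -
  have "strings 2 0 = {[]}" by (auto simp: strings_def)
  then show ?thesis by (simp add: rword_def pmf_of_set_singleton)
qed

lemma Cons_in_strings:
  "a # w \<in> strings 2 (Suc n) \<longleftrightarrow> a \<in> range letter \<and> w \<in> strings 2 n"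
proof -
  have "{1..2} = {1, 2 :: nat}" by auto
  then have "range letter = {1..2}" unfolding letter_def by auto
  then show ?thesis by (auto simp: strings_def)
qed

lemma inj_letter: "inj letter"
  by (auto simp: inj_def letter_def split: if_splits)

text \<open>Prepending a letter is a bijection onto the longer words, so a uniform word is a fair
  first letter followed by an independent uniform word.\<close>

lemma rword_Suc: "rword (Suc n) = coin \<bind> (\<lambda>b. map_pmf (Cons (letter b)) (rword n))"
proof -
  have "strings 2 (Suc n) = (\<lambda>(b, w). letter b # w) ` (UNIV \<times> strings 2 n)"
  proof (rule set_eqI)
    fix x show "x \<in> strings 2 (Suc n) \<longleftrightarrow> x \<in> (\<lambda>(b, w). letter b # w) ` (UNIV \<times> strings 2 n)"
    proof (cases x)
      case Nil
      then show ?thesis by (auto simp: strings_def)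
    next
      case (Cons a w)
      show ?thesis unfolding Cons Cons_in_strings by auto
    qed
  qed
  moreover have "inj_on (\<lambda>(b, w). letter b # w) (UNIV \<times> strings 2 n)"
    by (auto intro!: inj_onI dest: injD[OF inj_letter])
  ultimately have "map_pmf (\<lambda>(b, w). letter b # w) (pmf_of_set (UNIV \<times> strings 2 n)) = rword (Suc n)"
    unfolding rword_def
    by (simp add: map_pmf_of_set_inj strings_nonempty finite_strings)
  moreover have "pmf_of_set (UNIV \<times> strings 2 n) = pair_pmf coin (rword n)"
    unfolding coin_def rword_def bernoulli_pmf_half_conv_pmf_of_set
    by (rule pmf_eqI)
       (auto simp: pmf_pair finite_strings strings_nonempty indicator_def card_cartesian_product)
  ultimately have "rword (Suc n) = map_pmf (\<lambda>(b, w). letter b # w) (pair_pmf coin (rword n))"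
    by simp
  then show ?thesis
    by (simp add: pair_pmf_def map_bind_pmf map_pmf_def bind_assoc_pmf bind_return_pmf)
qed

lemma rword_add: "rword (m + n) = rword m \<bind> (\<lambda>x. map_pmf ((@) x) (rword n))"
proof (induction m)
  case 0
  then show ?case by (simp add: rword_0 bind_return_pmf map_pmf_idI)
next
  case (Suc m)
  have comp: "(#) a \<circ> (@) x = (@) (a # x)" for a :: nat and x
    by (simp add: fun_eq_iff)
  show ?case
    by (simp add: rword_Suc Suc map_bind_pmf bind_map_pmf bind_assoc_pmf pmf.map_comp comp)
qed

section \<open>Mean LCS length for prescribed lengths, and existence of the limit\<close>

definition rwords :: "'i set \<Rightarrow> ('i \<Rightarrow> nat) \<Rightarrow> ('i \<Rightarrow> nat list) pmf" where
  "rwords I v = Pi_pmf I [] (\<lambda>i. rword (v i))"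

text \<open>The lengths \<open>v i\<close> may differ because the greedy strategy uses up the
  strings at different speeds.\<close>

definition mean_LCS :: "'i set \<Rightarrow> ('i \<Rightarrow> nat) \<Rightarrow> real" where
  "mean_LCS I v = measure_pmf.expectation (rwords I v) (\<lambda>X. real (LCS I X))"

lemma finite_rwords: "finite I \<Longrightarrow> finite (set_pmf (rwords I v))"
  unfolding rwords_def by (rule finite_set_Pi_pmf) auto

lemma length_rwords: "finite I \<Longrightarrow> X \<in> set_pmf (rwords I v) \<Longrightarrow> i \<in> I \<Longrightarrow> length (X i) = v i"
  unfolding rwords_def by (rule length_rword) (rule in_set_Pi_pmfD)

lemma expected_LCS_eq: "expected_LCS 2 d n = mean_LCS {1..d} (\<lambda>_. n)"
  by (simp add: expected_LCS_def random_strings_def mean_LCS_def rwords_def rword_def)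

lemma mean_LCS_nonneg: "0 \<le> mean_LCS I v"
  by (simp add: mean_LCS_def)

text \<open>Cutting each string after \<open>u i\<close> letters leaves two independent families of
  uniform words, and common subsequences of the two families can be concatenated.\<close>

lemma mean_LCS_superadditive:
  assumes "finite I" "I \<noteq> {}"
  shows "mean_LCS I u + mean_LCS I v \<le> mean_LCS I (\<lambda>i. u i + v i)"
proof -
  have eq: "rwords I (\<lambda>i. u i + v i) = rwords I u \<bind>
      (\<lambda>x. map_pmf (\<lambda>y i. if i \<in> I then x i @ y i else []) (rwords I v))"
    unfolding rwords_def rword_add using assms(1)
    by (simp add: Pi_pmf_bind[where d' = "[]"] Pi_pmf_map_dependent[where dflt = "[]"])
  have "mean_LCS I u + mean_LCS I v = measure_pmf.expectation (rwords I u) (\<lambda>x.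
      measure_pmf.expectation (rwords I v) (\<lambda>y. real (LCS I x) + real (LCS I y)))"
    using finite_rwords[OF assms(1)]
    by (simp add: mean_LCS_def integrable_measure_pmf_finite)
  also have "\<dots> \<le> measure_pmf.expectation (rwords I u) (\<lambda>x.
      measure_pmf.expectation (rwords I v) (\<lambda>y. real (LCS I (\<lambda>i. if i \<in> I then x i @ y i else []))))"
  proof (intro expectation_mono_finite finite_rwords assms)
    fix x y :: "'a \<Rightarrow> nat list"
    have "LCS I (\<lambda>i. if i \<in> I then x i @ y i else []) = LCS I (\<lambda>i. x i @ y i)"
      by (rule LCS_cong) simp
    then show "real (LCS I x) + real (LCS I y) \<le> real (LCS I (\<lambda>i. if i \<in> I then x i @ y i else []))"
      using LCS_append[OF assms(2), of x y] by simp
  qed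
  also have "\<dots> = mean_LCS I (\<lambda>i. u i + v i)"
    unfolding mean_LCS_def eq using finite_rwords[OF assms(1)]
    by (subst expectation_bind_finite) auto
  finally show ?thesis .
qed

lemma mean_LCS_le:
  assumes "finite I" "i \<in> I"
  shows "mean_LCS I v \<le> real (v i)"
proof -
  have "mean_LCS I v \<le> measure_pmf.expectation (rwords I v) (\<lambda>_. real (v i))"
    unfolding mean_LCS_def
  proof (intro expectation_mono_finite finite_rwords assms)
    fix X assume "X \<in> set_pmf (rwords I v)"
    then show "real (LCS I X) \<le> real (v i)"
      using LCS_le_length[OF assms(2), of X] length_rwords[OF assms(1) _ assms(2)] by simp
  qed
  then show ?thesis by simp
qed

text \<open>Fekete's lemma; the limit is the supremum. For \<open>m\<close> with
  \<open>a m / m\<close> close to it, cut \<open>n\<close> into \<open>n div m\<close> blocks of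
  length \<open>m\<close> and drop the nonnegative contribution of the remainder.\<close>

lemma superadditive_convergent:
  fixes a :: "nat \<Rightarrow> real"
  assumes super: "\<And>m n. a m + a n \<le> a (m + n)"
    and nonneg: "\<And>n. 0 \<le> a n" and bound: "\<And>n. a n \<le> real n"
  shows "convergent (\<lambda>n. a n / real n)"
proof -
  define L where "L = (SUP n. a n / real n)"
  have le1: "a n / real n \<le> 1" for n
    using bound[of n] by (cases "n = 0") (auto simp: field_simps)
  then have bdd: "bdd_above (range (\<lambda>n. a n / real n))" by (intro bdd_aboveI2)
  have mult: "real q * a m \<le> a (q * m)" for q m
  proof (induction q)
    case (Suc q)
    then show ?case using super[of m "q * m"] by (simp add: algebra_simps)
  qed (use nonneg in auto)
  have "(\<lambda>n. a n / real n) \<longlonglongrightarrow> L"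
  proof (rule order_tendstoI)
    fix y assume "L < y"
    then show "\<forall>\<^sub>F n in sequentially. a n / real n < y"
      unfolding L_def using cSUP_upper[OF UNIV_I bdd] by (intro always_eventually) (meson le_less_trans)
  next
    fix y assume "y < L"
    then obtain m where m: "y < a m / real m"
      unfolding L_def by (subst (asm) less_cSUP_iff[OF _ bdd]) auto
    show "\<forall>\<^sub>F n in sequentially. y < a n / real n"
    \<comment> \<open>Division by zero yields \<open>0\<close>, so \<open>m = 0\<close> means
      \<open>y < 0\<close>, and nonnegativity suffices.\<close>
    proof (cases "m = 0")
      case True
      have "\<forall>\<^sub>F n in sequentially. 0 \<le> a n / real n"
        by (intro always_eventually) (use nonneg in auto)
      then show ?thesis using m True by (auto elim: eventually_mono)
    next
      case False
      have "(\<lambda>n. a m / real m * (1 - real m / real n)) \<longlonglongrightarrow> a m / real m * (1 - 0)"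
        by (intro tendsto_intros lim_const_over_n)
      then have "\<forall>\<^sub>F n in sequentially. y < a m / real m * (1 - real m / real n)"
        using m by (intro order_tendstoD) auto
      then show ?thesis using eventually_gt_at_top[of 0]
      proof eventually_elim
        case (elim n)
        have "real n = real (n div m) * real m + real (n mod m)"
          by (metis div_mult_mod_eq of_nat_add of_nat_mult)
        moreover have "real (n mod m) \<le> real m" using False by simp
        ultimately have "real n - real m \<le> real (n div m) * real m" by linarith
        then have "a m / real m * (real n - real m) \<le> a m / real m * (real (n div m) * real m)"
          using nonneg[of m] by (intro mult_left_mono) auto
        also have "\<dots> = real (n div m) * a m" using False by simp
        also have "\<dots> \<le> a (n div m * m)" by (rule mult)
        also have "\<dots> \<le> a (n div m * m) + a (n mod m)" using nonneg by simp
        also have "\<dots> \<le> a n" using super[of "n div m * m" "n mod m"] by simp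
        finally have "a m / real m * (real n - real m) / real n \<le> a n / real n"
          by (rule divide_right_mono) simp
        moreover have "a m / real m * (real n - real m) / real n = a m / real m * (1 - real m / real n)"
          using elim by (simp add: field_simps)
        ultimately show ?case using elim by linarith
      qed
    qed
  qed
  then show ?thesis by (rule convergentI)
qed

lemma expected_LCS_tendsto:
  assumes "d \<ge> 1"
  shows "(\<lambda>n. expected_LCS 2 d n / real n) \<longlonglongrightarrow> chvatal_sankoff 2 d"
proof -
  have "convergent (\<lambda>n. expected_LCS 2 d n / real n)"
  proof (rule superadditive_convergent)
    show "expected_LCS 2 d m + expected_LCS 2 d n \<le> expected_LCS 2 d (m + n)" for m n
      unfolding expected_LCS_eq by (rule mean_LCS_superadditive) (use assms in auto)
    show "0 \<le> expected_LCS 2 d n" for n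
      unfolding expected_LCS_eq by (rule mean_LCS_nonneg)
    show "expected_LCS 2 d n \<le> real n" for n
      unfolding expected_LCS_eq by (rule mean_LCS_le[of _ 1]) (use assms in auto)
  qed
  then show ?thesis unfolding chvatal_sankoff_def by (simp add: convergent_LIMSEQ_iff)
qed

subsection \<open>The upper bound\<close>

text \<open>A Chernoff bound. Reading \<open>x\<close> from the left, each letter matches the next
  letter needed from \<open>w\<close> with probability at most \<open>1 / 2\<close>; a match costs a
  factor \<open>exp s\<close>, a mismatch a factor \<open>1\<close>, on average
  \<open>(1 + exp s) / 2\<close>.\<close>

lemma subseq_prob_le:
  fixes s :: real
  assumes "s \<ge> 0"
  shows "measure_pmf.expectation (rword n) (\<lambda>x. of_bool (subseq w x))
    \<le> exp (- s * length w) * ((1 + exp s) / 2) ^ n"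
proof (induction n arbitrary: w)
  case 0
  then show ?case by (cases w) (auto simp: rword_0)
next
  case (Suc n)
  let ?M = "(1 + exp s) / 2"
  let ?f = "\<lambda>w. measure_pmf.expectation (rword n) (\<lambda>x. of_bool (subseq w x)) :: real"
  have split: "measure_pmf.expectation (rword (Suc n)) (\<lambda>x. of_bool (subseq w x)) =
    (measure_pmf.expectation (rword n) (\<lambda>x. of_bool (subseq w (letter True # x))) +
     measure_pmf.expectation (rword n) (\<lambda>x. of_bool (subseq w (letter False # x)))) / (2 :: real)"
    by (simp add: rword_Suc expectation_bind_finite expectation_coin)
  have "1 \<le> ?M" using assms by simp
  show ?case
  proof (cases w)
    case Nil
    then show ?thesis using one_le_power[OF \<open>1 \<le> ?M\<close>, of "Suc n"] by simp
  next
    case (Cons a u)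
    have step: "?f u \<le> exp s * (exp (- s * length w) * ?M ^ n)"
    proof -
      have "exp s * exp (- s * length w) = exp (- s * length u)"
        by (simp add: Cons algebra_simps flip: exp_add)
      then have "exp s * (exp (- s * length w) * ?M ^ n) = exp (- s * length u) * ?M ^ n"
        by (simp only: mult.assoc[symmetric])
      then show ?thesis using Suc.IH[of u] by (simp only:)
    qed
    have keep: "?f w \<le> exp (- s * length w) * ?M ^ n" by (rule Suc.IH)
    \<comment> \<open>As \<open>w\<close> is arbitrary, \<open>a\<close> may be neither of the two
      letters. Then both branches leave \<open>w\<close> unchanged, and one of them is given the
      weaker bound with the extra factor \<open>exp s\<close>.\<close>
    have "1 * (exp (- s * length w) * ?M ^ n) \<le> exp s * (exp (- s * length w) * ?M ^ n)"
      using assms by (intro mult_right_mono) (auto simp: add_nonneg_nonneg)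
    with keep have keep': "?f w \<le> exp s * (exp (- s * length w) * ?M ^ n)"
      by (simp only: mult_1_left)
    have one: "measure_pmf.expectation (rword n) (\<lambda>x. of_bool (subseq w (letter c # x))) =
      (if a = letter c then ?f u else ?f w)" for c
      by (simp add: Cons)
    have "measure_pmf.expectation (rword (Suc n)) (\<lambda>x. of_bool (subseq w x))
      \<le> (exp s * (exp (- s * length w) * ?M ^ n) + exp (- s * length w) * ?M ^ n) / 2"
      unfolding split one using step keep keep' by (auto simp: letter_def)
    also have "\<dots> = exp (- s * length w) * ?M ^ Suc n" by (simp add: algebra_simps)
    finally show ?thesis .
  qed
qed

text \<open>If the LCS is longer than \<open>l\<close>, some word of length \<open>l\<close> is
  common to all strings, and the LCS is at most \<open>n\<close>. So it is bounded by
  \<open>l\<close> plus \<open>n\<close> times the number of common words of length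
  \<open>l\<close>; by independence each of the \<open>2 ^ l\<close> words is common with a
  probability that is a product over the strings.\<close>

lemma mean_LCS_union_bound:
  fixes s :: real
  assumes "finite I" "I \<noteq> {}" "s \<ge> 0"
  shows "mean_LCS I (\<lambda>_. n) \<le> l + n * (2 ^ l * (exp (- s * l) * ((1 + exp s) / 2) ^ n) ^ card I)"
proof -
  let ?h = "\<lambda>w x. of_bool (subseq w x) :: real"
  let ?B = "exp (- s * l) * ((1 + exp s) / 2) ^ n"
  have "mean_LCS I (\<lambda>_. n) \<le> measure_pmf.expectation (rwords I (\<lambda>_. n))
      (\<lambda>X. l + n * (\<Sum>w\<in>strings 2 l. \<Prod>i\<in>I. ?h w (X i)))"
    unfolding mean_LCS_def
  proof (intro expectation_mono_finite finite_rwords assms)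
    fix X assume X: "X \<in> set_pmf (rwords I (\<lambda>_. n))"
    have nonneg: "0 \<le> (\<Sum>w\<in>strings 2 l. \<Prod>i\<in>I. ?h w (X i))"
      by (intro sum_nonneg prod_nonneg) auto
    show "real (LCS I X) \<le> l + n * (\<Sum>w\<in>strings 2 l. \<Prod>i\<in>I. ?h w (X i))"
    proof (cases "LCS I X \<le> l")
      case True
      then have "real (LCS I X) \<le> real l" by simp
      also have "\<dots> \<le> l + n * (\<Sum>w\<in>strings 2 l. \<Prod>i\<in>I. ?h w (X i))"
        using nonneg by simp
      finally show ?thesis .
    next
      case False
      obtain j where j: "j \<in> I" using assms by blast
      have Xj: "X j \<in> strings 2 n"
        using in_set_Pi_pmfD[OF assms(1) X[unfolded rwords_def] j] by (simp add: set_pmf_rword)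
      obtain w where w: "\<forall>i\<in>I. subseq w (X i)" "length w = LCS I X"
        by (rule LCS_witness[OF assms(2)])
      have sub: "subseq (take l w) (X i)" if "i \<in> I" for i
        using w(1) that subseq_order.trans[OF prefix_imp_subseq[OF take_is_prefix]] by blast
      have "set (take l w) \<subseteq> {1..2}"
        using sub[OF j] Xj list_emb_set[of "(=)" "take l w" "X j"] unfolding strings_def by blast
      then have in_strings: "take l w \<in> strings 2 l"
        using False w(2) by (simp add: strings_def)
      have "1 = (\<Prod>i\<in>I. ?h (take l w) (X i))" using sub by simp
      also have "\<dots> \<le> (\<Sum>w\<in>strings 2 l. \<Prod>i\<in>I. ?h w (X i))"
        using in_strings by (intro member_le_sum) (auto intro!: prod_nonneg simp: finite_strings)
      finally have "real n * 1 \<le> n * (\<Sum>w\<in>strings 2 l. \<Prod>i\<in>I. ?h w (X i))"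
        by (intro mult_left_mono) auto
      moreover have "real (LCS I X) \<le> n"
        using LCS_le_length[OF j, of X] Xj by (simp add: strings_def)
      ultimately show ?thesis by linarith
    qed
  qed
  also have "\<dots> = l + n * (\<Sum>w\<in>strings 2 l.
      measure_pmf.expectation (rwords I (\<lambda>_. n)) (\<lambda>X. \<Prod>i\<in>I. ?h w (X i)))"
    using finite_rwords[OF assms(1)]
    by (simp add: integrable_measure_pmf_finite)
  also have "\<dots> = l + n * (\<Sum>w\<in>strings 2 l. \<Prod>i\<in>I. measure_pmf.expectation (rword n) (?h w))"
    unfolding rwords_def using assms(1)
    by (subst expectation_prod_Pi_pmf) (auto intro!: integrable_measure_pmf_finite)
  also have "\<dots> \<le> l + n * (\<Sum>w\<in>strings 2 l. ?B ^ card I)"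
  proof (intro add_left_mono mult_left_mono sum_mono)
    fix w assume "w \<in> strings 2 l"
    then have "length w = l" by (simp add: strings_def)
    then have "measure_pmf.expectation (rword n) (?h w) \<le> ?B"
      using subseq_prob_le[OF assms(3), of n w] by simp
    then show "(\<Prod>i\<in>I. measure_pmf.expectation (rword n) (?h w)) \<le> ?B ^ card I"
      by (simp add: power_mono)
  qed auto
  also have "\<dots> = l + n * (2 ^ l * ?B ^ card I)"
    by (simp add: strings_def card_lists_length_eq)
  finally show ?thesis .
qed

text \<open>Follows from \<open>exp s \<le> 1 + s + s^2\<close> on the unit interval. The term
  \<open>s / 2\<close> will cancel against the mean, leaving an error quadratic in
  \<open>s\<close>.\<close>

lemma half_one_plus_exp_le:
  fixes s :: real
  assumes "0 \<le> s" "s \<le> 1"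
  shows "(1 + exp s) / 2 \<le> exp (s / 2 + s\<^sup>2 / 2)"
proof -
  have "(1 + exp s) / 2 \<le> 1 + (s / 2 + s\<^sup>2 / 2)"
    using exp_bound[OF assms] by simp
  also have "\<dots> \<le> exp (s / 2 + s\<^sup>2 / 2)" by (rule exp_ge_add_one_self)
  finally show ?thesis .
qed

lemma chvatal_sankoff_le_1:
  assumes "d \<ge> 1"
  shows "chvatal_sankoff 2 d \<le> 1"
proof (rule LIMSEQ_le_const2[OF expected_LCS_tendsto[OF assms]])
  have "expected_LCS 2 d n \<le> real n" for n
    unfolding expected_LCS_eq by (rule mean_LCS_le[of _ 1]) (use assms in auto)
  then show "\<exists>N. \<forall>n\<ge>N. expected_LCS 2 d n / real n \<le> 1"
    by (auto simp: divide_le_eq_1)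
qed

lemma expected_LCS_le:
  assumes "d \<ge> 16"
  shows "expected_LCS 2 d n \<le> (1 / 2 + 2 / sqrt d) * n + 2"
proof -
  \<comment> \<open>The same \<open>s\<close> serves as excess over \<open>1 / 2\<close> and as
    Chernoff parameter. Each string then contributes \<open>exp (- s^2 n / 2)\<close>, all
    \<open>d\<close> together \<open>exp (- 2 n)\<close>, which beats the at most
    \<open>exp n\<close> words. The assumption \<open>d \<ge> 16\<close> gives
    \<open>s \<le> 1 / 2\<close>, hence \<open>l \<le> n\<close>.\<close>
  define s where "s = 2 / sqrt d"
  define l where "l = nat \<lceil>(1 / 2 + s) * n\<rceil>"
  have "sqrt 16 \<le> sqrt d" using assms by (intro real_sqrt_le_mono) auto
  then have sqrt: "4 \<le> sqrt d" by simp
  then have "4 / sqrt d \<le> 1" by (subst divide_le_eq_1_pos) linarith+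
  then have s: "0 \<le> s" "s \<le> 1 / 2" by (auto simp: s_def)
  have sd: "s\<^sup>2 * d = 4" using assms by (simp add: s_def power_divide)
  have l: "(1 / 2 + s) * n \<le> l" "l \<le> (1 / 2 + s) * n + 1"
    unfolding l_def using s by (auto intro: order_trans[OF _ of_nat_ceiling] simp: of_nat_nat)
  have "(1 / 2 + s) * n \<le> 1 * real n" using s by (intro mult_right_mono) auto
  then have "l \<le> n" unfolding l_def by (simp add: ceiling_le_iff nat_le_iff)
  have "exp (- s * l) * ((1 + exp s) / 2) ^ n
      \<le> exp (- s * ((1 / 2 + s) * n)) * exp (s / 2 + s\<^sup>2 / 2) ^ n"
    using l(1) s
    by (intro mult_mono power_mono half_one_plus_exp_le) (auto intro!: mult_left_mono add_nonneg_nonneg)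
  also have "\<dots> = exp (- (s\<^sup>2 / 2 * n))"
    by (simp add: exp_of_nat_mult[symmetric] exp_add[symmetric] algebra_simps power2_eq_square)
  finally have "(exp (- s * l) * ((1 + exp s) / 2) ^ n) ^ d \<le> exp (- (s\<^sup>2 / 2 * n)) ^ d"
    by (intro power_mono) (auto intro!: mult_nonneg_nonneg add_nonneg_nonneg)
  also have "\<dots> = exp (- (s\<^sup>2 * d / 2 * n))"
    by (simp add: exp_of_nat_mult[symmetric] algebra_simps)
  also have "\<dots> = exp (- 2 * real n)" unfolding sd by simp
  finally have B: "(exp (- s * l) * ((1 + exp s) / 2) ^ n) ^ d \<le> exp (- 2 * real n)" .
  have two: "(2::real) \<le> exp 1" using exp_ge_add_one_self[of 1] by simp
  have "(2::real) ^ l \<le> exp 1 ^ n"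
    by (rule order_trans[OF power_increasing[OF \<open>l \<le> n\<close>] power_mono]) (use two in auto)
  then have "2 ^ l * (exp (- s * l) * ((1 + exp s) / 2) ^ n) ^ d \<le> exp 1 ^ n * exp (- 2 * real n)"
    using B by (intro mult_mono) auto
  also have "\<dots> = exp (- real n)"
    by (simp add: exp_of_nat_mult[symmetric] exp_add[symmetric])
  finally have "n * (2 ^ l * (exp (- s * l) * ((1 + exp s) / 2) ^ n) ^ d) \<le> n * exp (- real n)"
    by (intro mult_left_mono) auto
  also have "\<dots> \<le> 1"
  proof -
    have "real n \<le> exp (real n)" using exp_ge_add_one_self[of "real n"] by linarith
    then show ?thesis by (simp add: exp_minus field_simps)
  qed
  finally have tail: "n * (2 ^ l * (exp (- s * l) * ((1 + exp s) / 2) ^ n) ^ d) \<le> 1" .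
  \<comment> \<open>The additive \<open>2\<close> is one unit for rounding \<open>l\<close> up and
    one for the tail.\<close>
  have "expected_LCS 2 d n \<le> l + n * (2 ^ l * (exp (- s * l) * ((1 + exp s) / 2) ^ n) ^ d)"
    unfolding expected_LCS_eq using mean_LCS_union_bound[of "{1..d}" s n l] s assms by simp
  with tail l(2) show ?thesis unfolding s_def by linarith
qed

lemma chvatal_sankoff_upper:
  assumes "d \<ge> 1"
  shows "chvatal_sankoff 2 d \<le> 1 / 2 + 2 / sqrt d"
proof (cases "d \<ge> 16")
  case True
  have "(\<lambda>n. (1 / 2 + 2 / sqrt d) + 2 / real n) \<longlonglongrightarrow> (1 / 2 + 2 / sqrt d) + 0"
    by (intro tendsto_intros lim_const_over_n)
  then have lim: "(\<lambda>n. (1 / 2 + 2 / sqrt d) + 2 / real n) \<longlonglongrightarrow> 1 / 2 + 2 / sqrt d"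
    by simp
  show ?thesis
  proof (rule LIMSEQ_le[OF expected_LCS_tendsto[OF assms] lim], intro exI allI impI)
    fix n :: nat assume "1 \<le> n"
    then show "expected_LCS 2 d n / real n \<le> (1 / 2 + 2 / sqrt d) + 2 / real n"
      using divide_right_mono[OF expected_LCS_le[OF True, of n], of "real n"]
      by (simp add: add_divide_distrib)
  qed
next
  \<comment> \<open>For \<open>d < 16\<close> the claimed bound is at least the trivial bound
    \<open>1\<close>.\<close>
  case False
  then have "sqrt d \<le> sqrt 16" by (intro real_sqrt_le_mono) auto
  then have "1 \<le> 1 / 2 + 2 / sqrt d" using assms by (simp add: field_simps)
  with chvatal_sankoff_le_1[OF assms] show ?thesis by linarith
qed

subsection \<open>The greedy strategy\<close>

definition drop_through :: "'a \<Rightarrow> 'a list \<Rightarrow> 'a list" where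
  "drop_through a w = tl (dropWhile (\<lambda>x. x \<noteq> a) w)"

text \<open>A nonempty remainder certifies that \<open>a\<close> occurred. An empty one does not,
  since \<open>tl [] = []\<close>.\<close>

lemma subseq_Cons_drop_through:
  assumes "drop_through a w \<noteq> []"
  shows "subseq (a # drop_through a w) w"
proof -
  have "dropWhile (\<lambda>x. x \<noteq> a) w \<noteq> []"
    using assms unfolding drop_through_def by (metis list.sel(2))
  then have "dropWhile (\<lambda>x. x \<noteq> a) w = a # drop_through a w"
    unfolding drop_through_def using hd_dropWhile[of "\<lambda>x. x \<noteq> a" w]
    by (metis list.collapse)
  moreover have "subseq (dropWhile (\<lambda>x. x \<noteq> a) w) w"
    by (rule suffix_imp_subseq) (rule suffix_dropWhile)
  ultimately show ?thesis by simp
qed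

text \<open>The number of letters left in a uniformly random word of length \<open>m\<close> after deleting
  everything up to and including the first occurrence of a fixed letter; it is \<open>0\<close> also when
  the letter does not occur.\<close>

primrec rest_length :: "nat \<Rightarrow> nat pmf" where
  "rest_length 0 = return_pmf 0"
| "rest_length (Suc m) = coin \<bind> (\<lambda>x. if x then return_pmf m else rest_length m)"

lemma finite_rest_length [simp]: "finite (set_pmf (rest_length m))"
  by (induction m) auto

text \<open>Given its length, the remainder is again a uniform word. This lets the greedy strategy
  start afresh in every round.\<close>

lemma map_drop_through_rword: "map_pmf (drop_through (letter b)) (rword m) = rest_length m \<bind> rword"
proof (induction m)
  case 0
  then show ?case by (simp add: rword_0 drop_through_def bind_return_pmf)
next
  case (Suc m)
  have step: "map_pmf (drop_through (letter b)) (map_pmf (Cons (letter c)) (rword m)) =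
    (if c = b then rword m else rest_length m \<bind> rword)" for c
  proof -
    have "drop_through (letter b) \<circ> Cons (letter c) =
      (if c = b then (\<lambda>w. w) else drop_through (letter b))"
      by (auto simp: fun_eq_iff drop_through_def dest: injD[OF inj_letter])
    then show ?thesis using Suc by (simp add: pmf.map_comp map_pmf_ident)
  qed
  have "map_pmf (drop_through (letter b)) (rword (Suc m)) =
    coin \<bind> (\<lambda>c. if c = b then rword m else rest_length m \<bind> rword)"
    by (simp only: rword_Suc map_bind_pmf step)
  \<comment> \<open>The coin is symmetric, so the branches may be swapped when \<open>b\<close> is
    \<open>False\<close>.\<close>
  also have "\<dots> = coin \<bind> (\<lambda>x. if x then rword m else rest_length m \<bind> rword)"
    by (rule pmf_eqI) (cases b; simp add: pmf_bind expectation_coin)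
  also have "\<dots> = rest_length (Suc m) \<bind> rword"
    by (simp add: bind_assoc_pmf) (intro bind_pmf_cong refl, simp add: bind_return_pmf)
  finally show ?case .
qed

text \<open>In an infinite word the number \<open>g\<close> of deleted letters is geometric, and
  \<open>y ^ (-g)\<close> has mean \<open>1 / (2 * y - 1)\<close>, finite only for
  \<open>y > 1 / 2\<close>. The bound solves the recursion exactly and is an inequality only because
  of the start \<open>m = 0\<close>.\<close>

lemma expectation_power_rest_length:
  fixes y :: real
  assumes "1 / 2 < y" "y \<le> 1"
  shows "measure_pmf.expectation (rest_length m) (\<lambda>r. y ^ r) \<le> y ^ m / (2 * y - 1)"
proof (induction m)
  case 0
  then show ?case using assms by simp
next
  case (Suc m)
  have "measure_pmf.expectation (rest_length (Suc m)) (\<lambda>r. y ^ r) =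
    (y ^ m + measure_pmf.expectation (rest_length m) (\<lambda>r. y ^ r)) / 2"
    by (simp add: expectation_bind_finite expectation_coin)
  also have "\<dots> \<le> (y ^ m + y ^ m / (2 * y - 1)) / 2"
    by (intro divide_right_mono add_left_mono Suc) simp
  also have "\<dots> = y ^ Suc m / (2 * y - 1)" using assms by (simp add: field_simps)
  finally show ?case .
qed

text \<open>A string whose current letter is \<open>b\<close> spends that letter; any other string
  spends its next \<open>b\<close>.\<close>

lemma LCS_greedy_step:
  assumes "I \<noteq> {}" "\<And>i. i \<in> I \<Longrightarrow> y i = (if x i = b then w i else drop_through (letter b) (w i))"
    "\<And>i. i \<in> I \<Longrightarrow> y i \<noteq> []"
  shows "Suc (LCS I y) \<le> LCS I (\<lambda>i. letter (x i) # w i)"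
proof -
  have "Suc (LCS I y) \<le> LCS I (\<lambda>i. letter b # y i)" by (rule LCS_Cons[OF assms(1)])
  also have "\<dots> \<le> LCS I (\<lambda>i. letter (x i) # w i)"
  proof (rule LCS_mono[OF assms(1)])
    fix i assume i: "i \<in> I"
    show "subseq (letter b # y i) (letter (x i) # w i)"
    proof (cases "x i = b")
      case True
      then show ?thesis using assms(2)[OF i] by simp
    next
      case False
      then have "y i = drop_through (letter b) (w i)" using assms(2)[OF i] by simp
      then have "subseq (letter b # y i) (w i)"
        using subseq_Cons_drop_through assms(3)[OF i] by metis
      then show ?thesis by (rule list_emb_Cons)
    qed
  qed
  finally show ?thesis .
qed

text \<open>One round of the greedy strategy, which appends the letter \<open>b\<close> to the common subsequence:
  \<open>x i\<close> is the current letter of string \<open>i\<close>, and \<open>u i\<close> the number of letters after it.\<close>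

definition remaining :: "('i \<Rightarrow> bool) \<Rightarrow> bool \<Rightarrow> ('i \<Rightarrow> nat) \<Rightarrow> 'i \<Rightarrow> nat pmf" where
  "remaining x b u i = (if x i = b then return_pmf (u i) else rest_length (u i))"

lemma finite_remaining: "finite I \<Longrightarrow> finite (set_pmf (Pi_pmf I 0 (remaining x b u)))"
  by (rule finite_set_Pi_pmf) (auto simp: remaining_def)

text \<open>A string that is used up in this round may have failed to contain the letter \<open>b\<close>, so
  the round is counted only if every string has letters left.\<close>

lemma mean_LCS_greedy_round:
  assumes "finite I" "I \<noteq> {}"
  shows "measure_pmf.expectation (Pi_pmf I False (\<lambda>_. coin)) (\<lambda>x.
      measure_pmf.expectation (Pi_pmf I 0 (remaining x (maj x) u))
        (\<lambda>r. if \<forall>i\<in>I. r i \<noteq> 0 then 1 + mean_LCS I r else 0))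
    \<le> mean_LCS I (\<lambda>i. Suc (u i))"
proof -
  define h where "h = (\<lambda>y :: 'a \<Rightarrow> nat list. if \<forall>i\<in>I. y i \<noteq> [] then 1 + real (LCS I y) else 0)"
  define shrink where "shrink = (\<lambda>x (w :: 'a \<Rightarrow> nat list) i. if i \<in> I then
    (if x i = maj x then w i else drop_through (letter (maj x)) (w i)) else [])"
  have coins: "finite (set_pmf (Pi_pmf I False (\<lambda>_. coin)))"
    by (rule finite_set_Pi_pmf[OF assms(1)]) simp
  have words: "rwords I (\<lambda>i. Suc (u i)) = Pi_pmf I False (\<lambda>_. coin) \<bind>
      (\<lambda>x. map_pmf (\<lambda>w i. if i \<in> I then letter (x i) # w i else []) (rwords I u))"
    unfolding rwords_def rword_Suc using assms(1)
    by (simp add: Pi_pmf_bind[where d' = False] Pi_pmf_map_dependent[where dflt = "[]"])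
  \<comment> \<open>The chosen letter depends only on the current letters, so for fixed
    \<open>x\<close> the remainders are independent and, given their lengths, uniform.\<close>
  have law: "map_pmf (shrink x) (rwords I u) = Pi_pmf I 0 (remaining x (maj x) u) \<bind> rwords I" for x
  proof -
    have "map_pmf (shrink x) (rwords I u) = Pi_pmf I [] (\<lambda>i.
        map_pmf (\<lambda>w. if x i = maj x then w else drop_through (letter (maj x)) w) (rword (u i)))"
      unfolding rwords_def shrink_def using assms(1)
      by (subst Pi_pmf_map_dependent[where dflt = "[]"]) auto
    also have "\<dots> = Pi_pmf I [] (\<lambda>i. remaining x (maj x) u i \<bind> rword)"
      by (intro Pi_pmf_cong refl)
         (auto simp: remaining_def map_drop_through_rword bind_return_pmf map_pmf_ident)
    also have "\<dots> = Pi_pmf I 0 (remaining x (maj x) u) \<bind> rwords I"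
      using assms(1) by (subst Pi_pmf_bind[where d' = 0]) (auto simp: rwords_def[abs_def])
    finally show ?thesis .
  qed
  have h_mean: "measure_pmf.expectation (rwords I r) h =
      (if \<forall>i\<in>I. r i \<noteq> 0 then 1 + mean_LCS I r else 0)" for r
  proof -
    have "measure_pmf.expectation (rwords I r) h = measure_pmf.expectation (rwords I r)
        (\<lambda>y. if \<forall>i\<in>I. r i \<noteq> 0 then 1 + real (LCS I y) else 0)"
    proof (intro integral_cong_AE)
      show "AE y in measure_pmf (rwords I r). h y = (if \<forall>i\<in>I. r i \<noteq> 0 then 1 + real (LCS I y) else 0)"
        unfolding AE_measure_pmf_iff
      proof
        fix y assume "y \<in> set_pmf (rwords I r)"
        then have "(y i \<noteq> []) \<longleftrightarrow> (r i \<noteq> 0)" if "i \<in> I" for i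
          using length_rwords[OF assms(1) _ that, of y r] by (metis length_0_conv)
        then show "h y = (if \<forall>i\<in>I. r i \<noteq> 0 then 1 + real (LCS I y) else 0)"
          by (simp add: h_def)
      qed
    qed auto
    also have "\<dots> = (if \<forall>i\<in>I. r i \<noteq> 0 then 1 + mean_LCS I r else 0)"
    proof (cases "\<forall>i\<in>I. r i \<noteq> 0")
      case True
      then show ?thesis using finite_rwords[OF assms(1), of r]
        by (simp add: mean_LCS_def integrable_measure_pmf_finite)
    next
      case False
      show ?thesis unfolding if_not_P[OF False] by simp
    qed
    finally show ?thesis .
  qed
  have "measure_pmf.expectation (Pi_pmf I False (\<lambda>_. coin)) (\<lambda>x.
      measure_pmf.expectation (Pi_pmf I 0 (remaining x (maj x) u))
        (\<lambda>r. if \<forall>i\<in>I. r i \<noteq> 0 then 1 + mean_LCS I r else 0)) =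
    measure_pmf.expectation (Pi_pmf I False (\<lambda>_. coin)) (\<lambda>x.
      measure_pmf.expectation (map_pmf (shrink x) (rwords I u)) h)"
    unfolding law using assms(1)
    by (subst expectation_bind_finite) (auto simp: finite_remaining finite_rwords h_mean)
  also have "\<dots> \<le> measure_pmf.expectation (Pi_pmf I False (\<lambda>_. coin)) (\<lambda>x.
      measure_pmf.expectation (rwords I u)
        (\<lambda>w. real (LCS I (\<lambda>i. if i \<in> I then letter (x i) # w i else []))))"
    unfolding integral_map_pmf
  proof (intro expectation_mono_finite coins finite_rwords assms)
    fix x w
    have "LCS I (\<lambda>i. if i \<in> I then letter (x i) # w i else []) = LCS I (\<lambda>i. letter (x i) # w i)"
      by (rule LCS_cong) simp
    moreover have "Suc (LCS I (shrink x w)) \<le> LCS I (\<lambda>i. letter (x i) # w i)"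
      if "\<forall>i\<in>I. shrink x w i \<noteq> []"
      by (rule LCS_greedy_step[OF assms(2), where b = "maj x"]) (use that in \<open>auto simp: shrink_def\<close>)
    ultimately show "h (shrink x w) \<le> real (LCS I (\<lambda>i. if i \<in> I then letter (x i) # w i else []))"
      by (auto simp: h_def simp flip: of_nat_Suc)
  qed
  also have "\<dots> = mean_LCS I (\<lambda>i. Suc (u i))"
    unfolding mean_LCS_def words using coins finite_rwords[OF assms(1)]
    by (subst expectation_bind_finite) auto
  finally show ?thesis .
qed

text \<open>\<open>growth p y\<close> bounds the factor by which the mean of \<open>y ^ v\<close> grows in one round,
  where \<open>v\<close> is the number of letters left in a string and \<open>p\<close> the probability that its current
  letter is the chosen one.\<close>

definition growth :: "real \<Rightarrow> real \<Rightarrow> real" where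
  "growth p y = (p + (1 - p) / (2 * y - 1)) / y"

lemma growth_ge_1:
  assumes "1 / 2 < y" "y \<le> 1" "p \<le> 1"
  shows "1 \<le> growth p y"
proof -
  have "(1 - p) * 1 \<le> (1 - p) * (1 / (2 * y - 1))"
    using assms by (intro mult_left_mono) auto
  then have "y \<le> p + (1 - p) / (2 * y - 1)" using assms by simp
  then show ?thesis using assms by (simp add: growth_def)
qed

text \<open>The subtracted term is a union bound over the strings for the probability that the greedy
  strategy fails to complete \<open>t\<close> rounds.\<close>

lemma mean_LCS_ge:
  fixes y p :: real
  assumes I: "finite I" "I \<noteq> {}" and y: "1 / 2 < y" "y \<le> 1" and p: "p \<le> 1"
    and maj: "\<And>i. i \<in> I \<Longrightarrow>
      measure_pmf.expectation (Pi_pmf I False (\<lambda>_. coin)) (\<lambda>x. of_bool (x i = maj x)) = p"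
  shows "real t * (1 - growth p y ^ t * (\<Sum>i\<in>I. y ^ v i)) \<le> mean_LCS I v"
proof (induction t arbitrary: v)
  case 0
  then show ?case by (simp add: mean_LCS_nonneg)
next
  case (Suc t)
  let ?M = "growth p y"
  have M: "1 \<le> ?M ^ t" for t using growth_ge_1[OF y p] by (rule one_le_power)
  \<comment> \<open>An exhausted string contributes \<open>y ^ 0 = 1\<close> to the sum. The claimed
    lower bound is then nonpositive, hence trivial.\<close>
  have empty: "1 \<le> ?M ^ t * (\<Sum>i\<in>I. y ^ r i)" if "j \<in> I" "r j = 0" for r j t
  proof -
    have "1 \<le> (\<Sum>i\<in>I. y ^ r i)"
      using member_le_sum[of j I "\<lambda>i. y ^ r i"] that I y by simp
    then show ?thesis using mult_mono[OF M[of t], of 1 "\<Sum>i\<in>I. y ^ r i"] M[of t] by simp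
  qed
  show ?case
  proof (cases "\<exists>j\<in>I. v j = 0")
    case True
    then have "real (Suc t) * (1 - ?M ^ Suc t * (\<Sum>i\<in>I. y ^ v i)) \<le> 0"
      using empty by (intro mult_nonneg_nonpos) (auto simp del: power_Suc)
    then show ?thesis using mean_LCS_nonneg[of I v] by linarith
  next
    case False
    define u where "u = (\<lambda>i. v i - 1)"
    have vu: "v i = Suc (u i)" if "i \<in> I" for i using False that by (auto simp: u_def)
    let ?Q = "\<lambda>x. Pi_pmf I 0 (remaining x (maj x) u)"
    let ?X = "Pi_pmf I False (\<lambda>_. coin)"
    have coins: "finite (set_pmf ?X)"
      by (rule finite_set_Pi_pmf[OF I(1)]) simp
    let ?G = "1 / (2 * y - 1)"
    \<comment> \<open>The factor is \<open>1\<close> on agreement and \<open>?G\<close> otherwise.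
      Written affinely in the indicator, it can be averaged over the coins knowing only
      \<open>p\<close>.\<close>
    have one: "measure_pmf.expectation (remaining x b u i) (\<lambda>r. y ^ r) \<le>
        y ^ u i * (?G - (?G - 1) * of_bool (x i = b))" for x b i
      using expectation_power_rest_length[OF y, of "u i"] by (simp add: remaining_def)
    have round: "real (Suc t) * (1 - ?M ^ t * (\<Sum>i\<in>I. y ^ u i * (?G - (?G - 1) * of_bool (x i = maj x))))
      \<le> measure_pmf.expectation (?Q x) (\<lambda>r. if \<forall>i\<in>I. r i \<noteq> 0 then 1 + mean_LCS I r else 0)" for x
    proof -
      have int: "integrable (measure_pmf (?Q x)) f" for f :: "_ \<Rightarrow> real"
        by (rule integrable_measure_pmf_finite[OF finite_remaining[OF I(1)]])
      have "real (Suc t) * (1 - ?M ^ t * (\<Sum>i\<in>I. y ^ u i * (?G - (?G - 1) * of_bool (x i = maj x))))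
        \<le> real (Suc t) * (1 - ?M ^ t * (\<Sum>i\<in>I. measure_pmf.expectation (remaining x (maj x) u i) (\<lambda>r. y ^ r)))"
        using one M[of t] by (intro mult_left_mono diff_left_mono sum_mono) auto
      also have "\<dots> = real (Suc t) * (1 - ?M ^ t * (\<Sum>i\<in>I. measure_pmf.expectation (?Q x) (\<lambda>r. y ^ r i)))"
        using I by (simp add: expectation_Pi_component)
      also have "\<dots> = measure_pmf.expectation (?Q x) (\<lambda>r. real (Suc t) * (1 - ?M ^ t * (\<Sum>i\<in>I. y ^ r i)))"
        by (simp add: int Bochner_Integration.integral_diff)
      also have "\<dots> \<le> measure_pmf.expectation (?Q x) (\<lambda>r. if \<forall>i\<in>I. r i \<noteq> 0 then 1 + mean_LCS I r else 0)"
      proof (intro expectation_mono_finite finite_remaining I)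
        fix r
        show "real (Suc t) * (1 - ?M ^ t * (\<Sum>i\<in>I. y ^ r i)) \<le> (if \<forall>i\<in>I. r i \<noteq> 0 then 1 + mean_LCS I r else 0)"
        proof (cases "\<forall>i\<in>I. r i \<noteq> 0")
          case True
          have "0 \<le> ?M ^ t * (\<Sum>i\<in>I. y ^ r i)"
            using M[of t] y by (intro mult_nonneg_nonneg sum_nonneg) auto
          then have "real (Suc t) * (1 - ?M ^ t * (\<Sum>i\<in>I. y ^ r i))
            \<le> 1 + real t * (1 - ?M ^ t * (\<Sum>i\<in>I. y ^ r i))"
            by (simp add: algebra_simps)
          then show ?thesis using Suc.IH[of r] True by simp
        next
          case False
          then have "1 \<le> ?M ^ t * (\<Sum>i\<in>I. y ^ r i)" using empty by blast
          then have "real (Suc t) * (1 - ?M ^ t * (\<Sum>i\<in>I. y ^ r i)) \<le> 0"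
            by (intro mult_nonneg_nonpos) auto
          then show ?thesis using False by auto
        qed
      qed
      finally show ?thesis .
    qed
    \<comment> \<open>One factor \<open>?M\<close> pays exactly for the average change from
      \<open>y ^ v i\<close> in this round.\<close>
    have "real (Suc t) * (1 - ?M ^ Suc t * (\<Sum>i\<in>I. y ^ v i)) =
      real (Suc t) * (1 - ?M ^ t * (\<Sum>i\<in>I. y ^ u i * (?G - (?G - 1) * p)))"
    proof -
      have "?M * y ^ Suc k = y ^ k * (?G - (?G - 1) * p)" for k
      proof -
        have "?M * y = p + (1 - p) / (2 * y - 1)"
          using y by (simp add: growth_def)
        also have "\<dots> = ?G - (?G - 1) * p"
          by (simp add: algebra_simps diff_divide_distrib)
        finally have "?M * y = ?G - (?G - 1) * p" .
        then show ?thesis by (simp add: mult_ac)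
      qed
      then have "?M * (\<Sum>i\<in>I. y ^ v i) = (\<Sum>i\<in>I. y ^ u i * (?G - (?G - 1) * p))"
        unfolding sum_distrib_left by (intro sum.cong refl) (simp only: vu)
      then show ?thesis by (simp only: power_Suc2 mult.assoc)
    qed
    also have "\<dots> = measure_pmf.expectation ?X (\<lambda>x.
        real (Suc t) * (1 - ?M ^ t * (\<Sum>i\<in>I. y ^ u i * (?G - (?G - 1) * of_bool (x i = maj x)))))"
      by (simp add: integrable_measure_pmf_finite[OF coins] maj del: of_nat_Suc)
    also have "\<dots> \<le> measure_pmf.expectation ?X (\<lambda>x.
        measure_pmf.expectation (?Q x) (\<lambda>r. if \<forall>i\<in>I. r i \<noteq> 0 then 1 + mean_LCS I r else 0))"
      by (intro expectation_mono_finite coins round)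
    also have "\<dots> \<le> mean_LCS I (\<lambda>i. Suc (u i))"
      by (rule mean_LCS_greedy_round[OF I])
    also have "\<dots> = mean_LCS I v"
    proof -
      have "rwords I (\<lambda>i. Suc (u i)) = rwords I v"
        unfolding rwords_def by (intro Pi_pmf_cong) (auto simp: vu)
      then show ?thesis by (simp add: mean_LCS_def)
    qed
    finally show ?thesis .
  qed
qed

subsection \<open>The lower bound\<close>

definition central :: "nat \<Rightarrow> real" where
  "central n = real (n choose (n div 2)) / 2 ^ n"

lemma central_odd: "central (Suc (2 * m)) = central (2 * m) * (2 * m + 1) / (2 * m + 2)"
proof -
  have "(Suc (2 * m) choose m) * Suc m = Suc (2 * m) * (2 * m choose m)"
    using Suc_times_binomial_eq[of "2 * m" m] binomial_symmetric[of m "Suc (2 * m)"]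
    by (simp add: Suc_diff_le)
  then have "real (Suc (2 * m) choose m) * (real m + 1) = (2 * real m + 1) * real (2 * m choose m)"
    by (metis (mono_tags, lifting) of_nat_Suc of_nat_mult of_nat_numeral add.commute)
  then have "real (Suc (2 * m) choose m) = (2 * real m + 1) * real (2 * m choose m) / (real m + 1)"
    by (simp add: eq_divide_eq)
  then show ?thesis by (simp add: central_def algebra_simps)
qed

text \<open>By Pascal's rule, since the two middle coefficients of an odd row are equal.\<close>

lemma central_even: "central (2 * Suc m) = central (Suc (2 * m))"
proof -
  have "(Suc (2 * m) choose Suc m) = (Suc (2 * m) choose m)"
    using binomial_symmetric[of m "Suc (2 * m)"] by (simp add: Suc_diff_le)
  then have "2 * Suc m choose Suc m = 2 * (Suc (2 * m) choose m)"
    by simp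
  then show ?thesis by (simp add: central_def)
qed

text \<open>The quantity \<open>(central (2 * k))^2 * k\<close> is nondecreasing in \<open>k\<close>
  and equals \<open>1 / 4\<close> at \<open>k = 1\<close>.\<close>

lemma central_even_square: "1 / 4 \<le> (central (2 * Suc m))\<^sup>2 * (m + 1)"
proof (induction m)
  case 0
  show ?case by (simp add: central_def power2_eq_square)
next
  case (Suc m)
  have c: "central (2 * Suc (Suc m)) = central (2 * Suc m) * ((2 * m + 3) / (2 * m + 4))"
    unfolding central_even[of "Suc m"] central_odd by (simp add: algebra_simps)
  define x where "x = real m + 2"
  have x: "x > 0" by (simp add: x_def)
  have "x - 1 \<le> (2 * x - 1)\<^sup>2 / (4 * x)"
  proof (subst pos_le_divide_eq)
    show "(x - 1) * (4 * x) \<le> (2 * x - 1)\<^sup>2" by (simp add: power2_eq_square algebra_simps)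
  qed (use x in simp)
  also have "\<dots> = ((2 * x - 1) / (2 * x))\<^sup>2 * x"
    using x by (simp add: power2_eq_square)
  finally have "m + 1 \<le> ((2 * m + 3) / (2 * m + 4))\<^sup>2 * (m + 2)"
    by (simp add: x_def algebra_simps)
  then have "(central (2 * Suc m))\<^sup>2 * (m + 1)
      \<le> (central (2 * Suc m))\<^sup>2 * (((2 * m + 3) / (2 * m + 4))\<^sup>2 * (m + 2))"
    by (intro mult_left_mono) auto
  also have "\<dots> = (central (2 * Suc (Suc m)))\<^sup>2 * (Suc m + 1)"
    unfolding c power_mult_distrib by (simp add: algebra_simps)
  finally show ?case using Suc by linarith
qed

lemma central_square: "1 / 2 \<le> (central n)\<^sup>2 * (n + 1)"
proof (cases "n = 0")
  case True
  then show ?thesis by (simp add: central_def)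
next
  case False
  \<comment> \<open>Here \<open>2 * Suc m\<close> is \<open>n\<close> rounded up to an even number,
    which leaves \<open>central\<close> unchanged.\<close>
  define m where "m = (n - 1) div 2"
  have "n = 2 * Suc m \<or> n = Suc (2 * m)" using False unfolding m_def by presburger
  then have c: "central n = central (2 * Suc m)" and n: "2 * real (m + 1) \<le> n + 1"
    using central_even by auto
  have "1 / 2 \<le> (central n)\<^sup>2 * (2 * real (m + 1))"
    using central_even_square[of m] unfolding c by (simp add: algebra_simps)
  also have "\<dots> \<le> (central n)\<^sup>2 * (n + 1)" by (intro mult_left_mono n) simp
  finally show ?thesis .
qed

lemma central_ge: "1 / (2 * sqrt (real n + 1)) \<le> central n"
proof (rule power2_le_imp_le)
  have "(1 / (2 * sqrt (real n + 1)))\<^sup>2 = 1 / 4 / (real n + 1)"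
    by (simp add: power_divide power_mult_distrib)
  also have "\<dots> \<le> (central n)\<^sup>2"
    using central_square[of n] by (simp add: field_simps)
  finally show "(1 / (2 * sqrt (real n + 1)))\<^sup>2 \<le> (central n)\<^sup>2" .
qed (simp add: central_def)

lemma central_le_1: "central n \<le> 1"
proof -
  have "real (n choose (n div 2)) \<le> 2 ^ n"
    using binomial_le_pow2[of n "n div 2"] by (metis of_nat_le_iff of_nat_numeral of_nat_power)
  then show ?thesis by (simp add: central_def)
qed

section \<open>Agreement with the majority, and the resulting growth rate\<close>

definition majority :: "'i set \<Rightarrow> ('i \<Rightarrow> bool) \<Rightarrow> bool" where
  "majority I x \<longleftrightarrow> card I \<le> 2 * card {i\<in>I. x i}"

text \<open>The letter of string \<open>i\<close> tips the majority exactly if the other letters are balanced;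
  otherwise it agrees with the majority with probability \<open>1 / 2\<close>.\<close>

lemma agree_with_majority:
  assumes "finite I" "i \<in> I"
  shows "measure_pmf.expectation (Pi_pmf I False (\<lambda>_. coin)) (\<lambda>x. of_bool (x i = majority I x)) =
    1 / 2 + central (card I - 1) / 2"
proof -
  define J where "J = I - {i}"
  have J: "I = insert i J" "i \<notin> J" "finite J" "card I = Suc (card J)"
    using assms card_Suc_Diff1[OF assms] by (auto simp: J_def)
  let ?X = "Pi_pmf J False (\<lambda>_. coin)"
  let ?c = "\<lambda>f. card {j\<in>J. f j}"
  let ?k = "card J div 2"
  have fin: "finite (set_pmf ?X)" by (rule finite_set_Pi_pmf[OF J(3)]) simp
  have "{j\<in>I. (f(i := True)) j} = insert i {j\<in>J. f j}" "{j\<in>I. (f(i := False)) j} = {j\<in>J. f j}" for f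
    using J by auto
  then have cards: "card {j\<in>I. (f(i := True)) j} = Suc (?c f)" "card {j\<in>I. (f(i := False)) j} = ?c f" for f
    using J by auto
  have "measure_pmf.expectation (Pi_pmf I False (\<lambda>_. coin)) (\<lambda>x. of_bool (x i = majority I x)) =
    measure_pmf.expectation (coin \<bind> (\<lambda>y. map_pmf (\<lambda>f. f(i := y)) ?X))
      (\<lambda>x. of_bool (x i = (Suc (card J) \<le> 2 * card {i\<in>I. x i})) :: real)"
    unfolding majority_def J(4) using J(1-3) by (simp add: Pi_pmf_insert' map_pmf_def)
  also have "\<dots> = (measure_pmf.expectation ?X (\<lambda>f. of_bool (Suc (card J) \<le> 2 * Suc (?c f))) +
      measure_pmf.expectation ?X (\<lambda>f. of_bool (\<not> Suc (card J) \<le> 2 * ?c f))) / 2"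
    using fin by (subst expectation_bind_finite) (simp_all only: expectation_coin integral_map_pmf cards
      finite_coin set_map_pmf finite_imageI fun_upd_same simp_thms)
  also have "\<dots> = measure_pmf.expectation ?X (\<lambda>f. of_bool (Suc (card J) \<le> 2 * Suc (?c f)) +
      of_bool (\<not> Suc (card J) \<le> 2 * ?c f)) / 2"
    using integrable_measure_pmf_finite[OF fin] by (subst Bochner_Integration.integral_add) auto
  also have "\<dots> = measure_pmf.expectation ?X (\<lambda>f. 1 + indicator {?k} (?c f)) / 2"
  proof (intro arg_cong2[of _ _ _ _ "(/)"] refl Bochner_Integration.integral_cong)
    fix f
    \<comment> \<open>At least one value of the letter \<open>x i\<close> agrees with the majority.
      Both do exactly in the balanced case, which is \<open>c = d div 2\<close> for either parity
      because ties count as \<open>True\<close>.\<close>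
    have "(of_bool (Suc d \<le> 2 * Suc c) + of_bool (\<not> Suc d \<le> 2 * c) :: real) =
        1 + indicator {d div 2} c" for d c :: nat
    proof -
      have "(Suc d \<le> 2 * Suc c \<and> \<not> Suc d \<le> 2 * c) \<longleftrightarrow> c = d div 2" by presburger
      then show ?thesis by (auto simp: indicator_def)
    qed
    then show "of_bool (Suc (card J) \<le> 2 * Suc (?c f)) + of_bool (\<not> Suc (card J) \<le> 2 * ?c f) =
        (1 + indicator {?k} (?c f) :: real)" .
  qed
  also have "\<dots> = (1 + measure_pmf.expectation (map_pmf ?c ?X) (indicator {?k})) / 2"
    unfolding integral_map_pmf using integrable_measure_pmf_finite[OF fin] by (subst Bochner_Integration.integral_add) auto
  also have "map_pmf ?c ?X = binomial_pmf (card J) (1 / 2)"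
    unfolding coin_def by (rule binomial_pmf_altdef'[symmetric]) (use J in auto)
  also have "measure_pmf.expectation (binomial_pmf (card J) (1 / 2)) (indicator {?k}) = central (card J)"
    by (simp add: measure_pmf_single central_def power_divide flip: power_add)
  finally show ?thesis using J(4) by (simp add: add_divide_distrib)
qed

text \<open>At \<open>y = 1\<close> the left-hand side vanishes and has derivative \<open>1 - a * (3 - 2 * p)\<close>, where
  \<open>3 - 2 * p\<close> is the mean number of letters that a string loses in one round.\<close>

lemma growth_rate:
  assumes "a * (3 - 2 * p) < 1"
  obtains y where "1 / 2 < y" "y < 1" "ln y + a * ln (growth p y) < 0"
proof -
  let ?h = "\<lambda>y. ln y + a * ln ((p + (1 - p) / (2 * y - 1)) / y)"
  have "DERIV ?h 1 :> 1 - a * (3 - 2 * p)"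
    by (auto intro!: derivative_eq_intros simp: algebra_simps)
  moreover have "0 < 1 - a * (3 - 2 * p)" using assms by simp
  ultimately obtain e where e: "e > 0" "\<And>h. 0 < h \<Longrightarrow> h < e \<Longrightarrow> ?h (1 - h) < ?h 1"
    using DERIV_pos_inc_left by blast
  \<comment> \<open>The cap \<open>1 / 4\<close> keeps \<open>1 - h\<close> above
    \<open>1 / 2\<close>.\<close>
  define h where "h = min (e / 2) (1 / 4)"
  have "0 < h" "h < e" "h \<le> 1 / 4" using e(1) by (auto simp: h_def)
  with e(2)[of h] show thesis
    by (intro that[of "1 - h"]) (auto simp: growth_def)
qed

text \<open>Run about \<open>a * n\<close> greedy rounds. Each costs a string
  \<open>2 - central (d - 1)\<close> letters on average, less than \<open>1 / a\<close>, so the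
  failure bound decays like \<open>d * q ^ n\<close> with \<open>q < 1\<close>.\<close>

lemma chvatal_sankoff_ge_rate:
  assumes d: "d \<ge> 1" and a: "0 < a" "a * (2 - central (d - 1)) < 1"
  shows "a \<le> chvatal_sankoff 2 d"
proof -
  define p where "p = 1 / 2 + central (d - 1) / 2"
  have p: "p \<le> 1" using central_le_1[of "d - 1"] by (simp add: p_def)
  have "a * (3 - 2 * p) < 1" using a(2) by (simp add: p_def)
  then obtain y where y: "1 / 2 < y" "y < 1" "ln y + a * ln (growth p y) < 0"
    by (rule growth_rate)
  define M where "M = growth p y"
  define q where "q = exp (ln y + a * ln M)"
  have M: "1 \<le> M" unfolding M_def using y p by (intro growth_ge_1) auto
  have q: "0 < q" "q < 1" using y(3) by (auto simp: q_def M_def)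
  have qn: "(\<lambda>n. 1 - d * q ^ n) \<longlonglongrightarrow> 1 - real d * 0"
    using q by (intro tendsto_intros LIMSEQ_realpow_zero) auto
  have lim: "(\<lambda>n. (a - 1 / real n) * (1 - d * q ^ n)) \<longlonglongrightarrow> (a - 0) * (1 - real d * 0)"
    by (intro tendsto_mult tendsto_diff tendsto_const lim_const_over_n qn)
  have "\<forall>\<^sub>F n in sequentially. 0 < 1 - d * q ^ n"
    using qn by (rule order_tendstoD) simp
  then have "\<forall>\<^sub>F n in sequentially. (a - 1 / real n) * (1 - d * q ^ n) \<le> expected_LCS 2 d n / real n"
    using eventually_gt_at_top[of 0]
  proof eventually_elim
    case (elim n)
    define t where "t = nat \<lfloor>a * n\<rfloor>"
    have "0 \<le> a * n" using a(1) by simp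
    then have t: "a * n - 1 \<le> t" "t \<le> a * n" unfolding t_def by linarith+
    have "M ^ t * y ^ n = exp (t * ln M + n * ln y)"
      using M y by (simp add: exp_add exp_of_nat_mult)
    also have "\<dots> \<le> exp (a * n * ln M + n * ln y)"
      using t(2) M by (simp add: mult_right_mono)
    also have "\<dots> = q ^ n"
      by (simp add: q_def exp_of_nat_mult[symmetric] algebra_simps)
    finally have small: "M ^ t * y ^ n \<le> q ^ n" .
    have "(a * n - 1) * (1 - d * q ^ n) \<le> t * (1 - d * q ^ n)"
      using t(1) elim by (intro mult_right_mono) auto
    also have "\<dots> \<le> t * (1 - d * (M ^ t * y ^ n))"
      using small by (intro mult_left_mono diff_left_mono) auto
    also have "\<dots> = t * (1 - growth p y ^ t * (\<Sum>i\<in>{1..d}. y ^ n))"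
      by (simp add: M_def)
    also have "\<dots> \<le> expected_LCS 2 d n"
      unfolding expected_LCS_eq
      by (rule mean_LCS_ge[where maj = "majority {1..d}"])
         (use d y p agree_with_majority[of "{1..d}"] in \<open>auto simp: p_def\<close>)
    finally have "(a * n - 1) * (1 - d * q ^ n) / n \<le> expected_LCS 2 d n / n"
      by (rule divide_right_mono) simp
    moreover have "(a * n - 1) * (1 - d * q ^ n) / n = (a - 1 / real n) * (1 - d * q ^ n)"
      using elim(2) by (simp add: field_simps)
    ultimately show ?case by simp
  qed
  then have "(a - 0) * (1 - real d * 0) \<le> chvatal_sankoff 2 d"
    by (rule tendsto_le[OF sequentially_bot expected_LCS_tendsto[OF d] lim])
  then show ?thesis by simp
qed

lemma chvatal_sankoff_lower:
  assumes "d \<ge> 1"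
  shows "1 / 2 + (1 / 8) / sqrt d \<le> chvatal_sankoff 2 d"
proof -
  define c where "c = central (d - 1)"
  have c: "1 / (2 * sqrt d) \<le> c" "c \<le> 1"
    using central_ge[of "d - 1"] central_le_1[of "d - 1"] assms by (auto simp: c_def of_nat_diff)
  have "0 < 1 / (2 * sqrt d)" using assms by simp
  with c(1) have "0 < c" by linarith
  \<comment> \<open>The constant \<open>1 / 8\<close> comes from \<open>c / 4\<close> with
    \<open>c \<ge> 1 / (2 * sqrt d)\<close>. The next inequality holds because
    \<open>(1 / 2 + c / 4) * (2 - c) = 1 - c^2 / 4\<close>.\<close>
  have "1 / 2 + (1 / 8) / sqrt d \<le> 1 / 2 + c / 4" using c(1) by simp
  also have "\<dots> \<le> 1 / (2 - c)"
    using c(2) \<open>0 < c\<close> by (simp add: field_simps)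
  also have "\<dots> \<le> chvatal_sankoff 2 d"
  \<comment> \<open>Only rates strictly below \<open>1 / (2 - c)\<close> are achieved directly, so
    the bound is reached as their supremum.\<close>
  proof (rule dense_le_bounded[of 0])
    fix a assume "0 < a" "a < 1 / (2 - c)"
    then show "a \<le> chvatal_sankoff 2 d"
      using c(2) by (intro chvatal_sankoff_ge_rate assms) (auto simp: c_def pos_less_divide_eq)
  qed (use c(2) in auto)
  finally show ?thesis .
qed

theorem theorem1:
  shows "\<exists>c1 c2 :: real. 0 < c1 \<and> c1 < c2 \<and>
    (\<forall>d::nat. d \<ge> 2 \<longrightarrow>
       1 / 2 + c1 / sqrt (real d) \<le> chvatal_sankoff 2 d \<and>
       chvatal_sankoff 2 d \<le> 1 / 2 + c2 / sqrt (real d))"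
proof (intro exI conjI allI impI)
  fix d :: nat assume "d \<ge> 2"
  then have "d \<ge> 1" by simp
  then show "1 / 2 + (1 / 8) / sqrt d \<le> chvatal_sankoff 2 d"
    and "chvatal_sankoff 2 d \<le> 1 / 2 + 2 / sqrt d"
    by (rule chvatal_sankoff_lower, rule chvatal_sankoff_upper)
qed simp_all

end
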